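(* Let $(\mathfrak g,\varphi,\xi,\eta)$ be an almost contact Lie algebra. Then: 1. the structure is normal if and only if $\mathfrak h^{1,0}$ is an $\mathrm{ad}_\xi$-invariant subalgebra of $\mathfrak g^{\mathbb C}$; 2. the structure is abelian if and only if $\mathfrak h^{1,0}$ is an $\mathrm{ad}_\xi$-invariant abelian subalgebra of $\mathfrak g^{\mathbb C}$.
   Context: An almost contact Lie algebra is a real Lie algebra $\mathfrak g$ of dimension $2n+1$ with $(\varphi,\xi,\eta)$, $\varphi\in\mathrm{End}(\mathfrak g)$, $\xi\in\mathfrak g$, $\eta\in\mathfrak g^*$, such that $\varphi^2=-I+\eta\otimes\xi$ and $\eta(\xi)=1$ (hence $\varphi\xi=0$, $\eta\circ\varphi=0$). Set $\mathfrak h=\operatorname{Ker}\eta$ and $J=\varphi|_{\mathfrak h}:\mathfrak h\to\mathfrak h$, which satisfies $J^2=-I$. In the complexification $\mathfrak g^{\mathbb C}=\mathfrak g\otimes_{\mathbb R}\mathbb C$, $\mathfrak h^{1,0}=\{X-iJX\mid X\in\mathfrak h\}$ is the $i$-eigenspace of $J$ on $\mathfrak h^{\mathbb C}$. The structure is normal if $N_\varphi=[\varphi,\varphi]+d\eta\otimes\xi$ vanishes on $\mathfrak g$, where $[\varphi,\varphi](X,Y)=[\varphi X,\varphi Y]+\varphi^2[X,Y]-\varphi[\varphi X,Y]-\varphi[X,\varphi Y]$ and $d\eta(X,Y)=-\eta([X,Y])$. It is abelian if $\mathrm{ad}_\xi\circ\varphi=\varphi\circ\mathrm{ad}_\xi$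 and $[\varphi X,\varphi Y]=[X,Y]$ for all $X,Y\in\mathfrak h$. *)

theory Defs
  imports "HOL-Analysis.Product_Vector"
begin

section \<open>Lie algebras over a field\<close>

locale lie_algebra = vector_space scale
  for scale :: "'k::field \<Rightarrow> 'v::ab_group_add \<Rightarrow> 'v" +
  fixes bracket :: "'v \<Rightarrow> 'v \<Rightarrow> 'v"
  assumes linear_left: "\<And>y. Vector_Spaces.linear scale scale (\<lambda>x. bracket x y)"
    and linear_right: "\<And>x. Vector_Spaces.linear scale scale (bracket x)"
    and alternating: "\<And>x. bracket x x = 0"
    and jacobi: "\<And>x y z. bracket x (bracket y z) + bracket y (bracket z x)
                   + bracket z (bracket x y) = 0"

definition ad :: "('v \<Rightarrow> 'v \<Rightarrow> 'v) \<Rightarrow> 'v \<Rightarrow> 'v \<Rightarrow> 'v" where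
  "ad bracket x = (\<lambda>y. bracket x y)"

definition ad_invariant :: "('v \<Rightarrow> 'v \<Rightarrow> 'v) \<Rightarrow> 'v \<Rightarrow> 'v set \<Rightarrow> bool" where
  "ad_invariant bracket x S \<longleftrightarrow> ad bracket x ` S \<subseteq> S"

definition lie_subalgebra ::
    "('k::field \<Rightarrow> 'v::ab_group_add \<Rightarrow> 'v) \<Rightarrow> ('v \<Rightarrow> 'v \<Rightarrow> 'v) \<Rightarrow> 'v set \<Rightarrow> bool" where
  "lie_subalgebra scl bracket S \<longleftrightarrow>
     module.subspace scl S \<and> (\<forall>x\<in>S. \<forall>y\<in>S. bracket x y \<in> S)"

definition abelian_lie_subalgebra ::
    "('k::field \<Rightarrow> 'v::ab_group_add \<Rightarrow> 'v) \<Rightarrow> ('v \<Rightarrow> 'v \<Rightarrow> 'v) \<Rightarrow> 'v set \<Rightarrow> bool" where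
  "abelian_lie_subalgebra scl bracket S \<longleftrightarrow>
     lie_subalgebra scl bracket S \<and> (\<forall>x\<in>S. \<forall>y\<in>S. bracket x y = 0)"


section \<open>Complexification of a real Lie algebra\<close>

text \<open>
  The complexification of a real vector space is modelled on pairs, where \<open>(x, y)\<close> stands
  for \<open>x \<otimes> 1 + y \<otimes> \<i>\<close>, i.e. for \<open>x + \<i> y\<close>. Addition is that of the product type; the
  complex scalars and the complex bilinear extension of the bracket are the following.
\<close>

definition scaleC :: "complex \<Rightarrow> 'a::real_vector \<times> 'a \<Rightarrow> 'a \<times> 'a" where
  "scaleC c z = (Re c *\<^sub>R fst z - Im c *\<^sub>R snd z, Re c *\<^sub>R snd z + Im c *\<^sub>R fst z)"

definition complexify :: "'a::real_vector \<Rightarrow> 'a \<times> 'a" where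
  "complexify x = (x, 0)"

definition bracketC :: "('a::real_vector \<Rightarrow> 'a \<Rightarrow> 'a) \<Rightarrow> 'a \<times> 'a \<Rightarrow> 'a \<times> 'a \<Rightarrow> 'a \<times> 'a" where
  "bracketC bracket z w =
     (bracket (fst z) (fst w) - bracket (snd z) (snd w),
      bracket (fst z) (snd w) + bracket (snd z) (fst w))"

lemma vector_space_scaleC: "vector_space (scaleC :: complex \<Rightarrow> 'a::real_vector \<times> 'a \<Rightarrow> 'a \<times> 'a)"
  by unfold_locales (auto simp: scaleC_def algebra_simps)

lemma pair_eq_complexify: "(x, y) = complexify x + scaleC \<i> (complexify y)"
  by (simp add: complexify_def scaleC_def)

lemma bracketC_complexify:
  assumes "lie_algebra scaleR bracket"
  shows "bracketC bracket (complexify x) (complexify y) = complexify (bracket x y)"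
proof -
  interpret lie_algebra scaleR bracket by fact
  have "linear (\<lambda>x. bracket x z)" "linear (bracket z)" for z
    using linear_left linear_right by (simp_all add: linear_def)
  from linear_0[OF this(1)] linear_0[OF this(2)] show ?thesis
    by (simp add: bracketC_def complexify_def)
qed

lemma lie_algebra_complexification:
  assumes "lie_algebra scaleR bracket"
  shows "lie_algebra scaleC (bracketC bracket)"
proof -
  interpret L: lie_algebra scaleR bracket by fact
  have l: "linear (\<lambda>x. bracket x y)" and r: "linear (bracket y)" for y
    using L.linear_left L.linear_right by (simp_all add: linear_def)
  note bil = linear_add[OF l] linear_add[OF r] linear_diff[OF l] linear_diff[OF r]
    linear_cmul[OF l] linear_cmul[OF r]
  interpret vector_space "scaleC :: complex \<Rightarrow> 'a \<times> 'a \<Rightarrow> 'a \<times> 'a"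
    by (rule vector_space_scaleC)
  have anti: "bracket x y = - bracket y x" for x y
    using L.alternating[of "x + y"] L.alternating[of x] L.alternating[of y]
    by (simp add: bil eq_neg_iff_add_eq_0 add.commute)
  have jac: "bracket x (bracket y z) = - bracket y (bracket z x) - bracket z (bracket x y)" for x y z
    using L.jacobi[of x y z] by (metis add_diff_cancel_right' diff_0 diff_diff_eq2 add.commute uminus_add_conv_diff)
  show ?thesis
  proof unfold_locales
    fix z :: "'a \<times> 'a"
    show "bracketC bracket z z = 0"
      using anti[of "snd z" "fst z"] by (simp add: bracketC_def L.alternating zero_prod_def)
  next
    fix x y z :: "'a \<times> 'a"
    obtain a b c d e f where "x = (a, b)" "y = (c, d)" "z = (e, f)"
      by (metis surj_pair)
    then show "bracketC bracket x (bracketC bracket y z) + bracketC bracket y (bracketC bracket z x)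
            + bracketC bracket z (bracketC bracket x y) = 0"
      using jac[of a c e] jac[of a c f] jac[of a d e] jac[of a d f]
        jac[of b c e] jac[of b c f] jac[of b d e] jac[of b d f]
      by (simp add: bracketC_def bil zero_prod_def)
  qed (auto simp: bracketC_def scaleC_def bil algebra_simps)
qed


section \<open>Almost contact Lie algebras\<close>

text \<open>
  As \<open>dim\<close> is \<open>0\<close> on infinite-dimensional spaces, \<open>dim_eq\<close> includes finite-dimensionality.
\<close>

locale almost_contact_lie_algebra = lie_algebra scaleR bracket
  for n :: nat
    and bracket :: "'a::real_vector \<Rightarrow> 'a \<Rightarrow> 'a"
    and \<phi> :: "'a \<Rightarrow> 'a" and \<xi> :: 'a and \<eta> :: "'a \<Rightarrow> real" +
  assumes dim_eq: "dim (UNIV :: 'a set) = 2 * n + 1"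
    and linear_phi: "linear \<phi>"
    and linear_eta: "linear \<eta>"
    and phi_phi: "\<And>X. \<phi> (\<phi> X) = - X + \<eta> X *\<^sub>R \<xi>"
    and eta_xi: "\<eta> \<xi> = 1"

definition Ker :: "('a \<Rightarrow> real) \<Rightarrow> 'a set" where
  "Ker \<eta> = {X. \<eta> X = 0}"

definition nijenhuis :: "('a::real_vector \<Rightarrow> 'a \<Rightarrow> 'a) \<Rightarrow> ('a \<Rightarrow> 'a) \<Rightarrow> 'a \<Rightarrow> 'a \<Rightarrow> 'a" where
  "nijenhuis bracket \<phi> X Y =
     bracket (\<phi> X) (\<phi> Y) + \<phi> (\<phi> (bracket X Y)) - \<phi> (bracket (\<phi> X) Y) - \<phi> (bracket X (\<phi> Y))"

definition d_form :: "('a \<Rightarrow> 'a \<Rightarrow> 'a) \<Rightarrow> ('a \<Rightarrow> real) \<Rightarrow> 'a \<Rightarrow> 'a \<Rightarrow> real" where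
  "d_form bracket \<eta> X Y = - \<eta> (bracket X Y)"

definition normal_structure ::
    "('a::real_vector \<Rightarrow> 'a \<Rightarrow> 'a) \<Rightarrow> ('a \<Rightarrow> 'a) \<Rightarrow> 'a \<Rightarrow> ('a \<Rightarrow> real) \<Rightarrow> bool" where
  "normal_structure bracket \<phi> \<xi> \<eta> \<longleftrightarrow>
     (\<forall>X Y. nijenhuis bracket \<phi> X Y + d_form bracket \<eta> X Y *\<^sub>R \<xi> = 0)"

definition abelian_structure ::
    "('a \<Rightarrow> 'a \<Rightarrow> 'a) \<Rightarrow> ('a \<Rightarrow> 'a) \<Rightarrow> 'a \<Rightarrow> ('a \<Rightarrow> real) \<Rightarrow> bool" where
  "abelian_structure bracket \<phi> \<xi> \<eta> \<longleftrightarrow>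
     ad bracket \<xi> \<circ> \<phi> = \<phi> \<circ> ad bracket \<xi> \<and>
     (\<forall>X\<in>Ker \<eta>. \<forall>Y\<in>Ker \<eta>. bracket (\<phi> X) (\<phi> Y) = bracket X Y)"

text \<open>
  On \<open>Ker \<eta>\<close> the map \<open>J\<close> is the restriction of \<open>\<phi>\<close>, so \<open>J X\<close> is written \<open>\<phi> X\<close>.
\<close>

definition h10 :: "('a::real_vector \<Rightarrow> 'a) \<Rightarrow> ('a \<Rightarrow> real) \<Rightarrow> ('a \<times> 'a) set" where
  "h10 \<phi> \<eta> = {complexify X - scaleC \<i> (complexify (\<phi> X)) | X. X \<in> Ker \<eta>}"

context almost_contact_lie_algebra
begin

lemma phi_xi: "\<phi> \<xi> = 0"
proof -
  have *: "\<eta> (\<phi> \<xi>) *\<^sub>R \<xi> = \<phi> \<xi>"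
    using phi_phi[of "\<phi> \<xi>"] phi_phi[of \<xi>] by (simp add: eta_xi linear_0[OF linear_phi])
  have "\<phi> (\<phi> \<xi>) = 0"
    using phi_phi[of \<xi>] by (simp add: eta_xi)
  then have "\<eta> (\<phi> \<xi>) *\<^sub>R \<phi> \<xi> = 0"
    by (metis * linear_cmul[OF linear_phi])
  then show ?thesis
    using * by auto
qed

lemma eta_phi: "\<eta> (\<phi> X) = 0"
proof -
  have "\<phi> (\<phi> (\<phi> X)) = - \<phi> X"
    by (simp add: phi_phi[of X] linear_add[OF linear_phi] linear_neg[OF linear_phi]
        linear_cmul[OF linear_phi] linear_diff[OF linear_phi] phi_xi)
  then have "\<eta> (\<phi> X) *\<^sub>R \<xi> = 0"
    using phi_phi[of "\<phi> X"] by simp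
  moreover have "\<xi> \<noteq> 0"
    using eta_xi linear_0[OF linear_eta] by force
  ultimately show ?thesis by simp
qed

lemma h10_eq_eigenspace:
  "h10 \<phi> \<eta> = {z \<in> Ker \<eta> \<times> Ker \<eta>. map_prod \<phi> \<phi> z = scaleC \<i> z}"
proof (intro set_eqI iffI)
  fix z assume "z \<in> h10 \<phi> \<eta>"
  then show "z \<in> {z \<in> Ker \<eta> \<times> Ker \<eta>. map_prod \<phi> \<phi> z = scaleC \<i> z}"
    by (auto simp: h10_def Ker_def complexify_def scaleC_def eta_phi phi_phi
        linear_neg[OF linear_eta] linear_neg[OF linear_phi])
next
  fix z assume "z \<in> {z \<in> Ker \<eta> \<times> Ker \<eta>. map_prod \<phi> \<phi> z = scaleC \<i> z}"
  then have "fst z \<in> Ker \<eta>" "z = complexify (fst z) - scaleC \<i> (complexify (\<phi> (fst z)))"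
    by (auto simp: complexify_def scaleC_def)
  then show "z \<in> h10 \<phi> \<eta>"
    unfolding h10_def by blast
qed

end

end

theory Submission
  imports Defs
begin

text \<open>
  For \<open>X, Y \<in> Ker \<eta>\<close> put \<open>A = [X, Y] - [\<phi> X, \<phi> Y]\<close> and \<open>B = [\<phi> X, Y] + [X, \<phi> Y]\<close>. The bracket
  of \<open>X - \<i> \<phi> X\<close> and \<open>Y - \<i> \<phi> Y\<close> is \<open>A - \<i> B\<close>, whereas the normality tensor is \<open>- A - \<phi> B\<close>.
  Replacing \<open>X\<close> by \<open>\<phi> X\<close> turns \<open>(A, B)\<close> into \<open>(B, - A)\<close>; hence \<open>A = - \<phi> B\<close> identically iff
  \<open>B = \<phi> A\<close> identically, and \<open>A = 0\<close> identically implies \<open>B = 0\<close> identically. The remaining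
  component of normality, with one argument equal to \<open>\<xi>\<close>, says that \<open>ad \<xi>\<close> commutes with \<open>\<phi>\<close>.
\<close>

context almost_contact_lie_algebra
begin

lemma linear_bracket_left: "linear (\<lambda>x. bracket x y)"
  and linear_bracket_right: "linear (bracket x)"
  using linear_left linear_right by (simp_all add: linear_def)

lemmas bracket_linear_simps =
  linear_0[OF linear_bracket_left] linear_0[OF linear_bracket_right]
  linear_add[OF linear_bracket_left] linear_add[OF linear_bracket_right]
  linear_diff[OF linear_bracket_left] linear_diff[OF linear_bracket_right]
  linear_neg[OF linear_bracket_left] linear_neg[OF linear_bracket_right]
  linear_cmul[OF linear_bracket_left] linear_cmul[OF linear_bracket_right]

lemmas phi_linear_simps =
  linear_0[OF linear_phi] linear_add[OF linear_phi] linear_diff[OF linear_phi]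
  linear_neg[OF linear_phi] linear_cmul[OF linear_phi]

lemmas eta_linear_simps =
  linear_0[OF linear_eta] linear_add[OF linear_eta] linear_diff[OF linear_eta]
  linear_neg[OF linear_eta] linear_cmul[OF linear_eta]

lemma bracket_antisym: "bracket x y = - bracket y x"
  using alternating[of "x + y"] alternating[of x] alternating[of y]
  by (simp add: bracket_linear_simps eq_neg_iff_add_eq_0 add.commute)

text \<open>In the pair model \<open>X - \<i> \<phi> X\<close> is \<open>(X, - \<phi> X)\<close>, so
  conditions on \<open>h10 \<phi> \<eta>\<close> become real conditions on
  \<open>Ker \<eta>\<close>.\<close>

lemma mem_h10_iff: "(x, y) \<in> h10 \<phi> \<eta> \<longleftrightarrow> \<eta> x = 0 \<and> y = - \<phi> x"
  by (auto simp: h10_def complexify_def scaleC_def Ker_def)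

lemma subspace_h10: "module.subspace scaleC (h10 \<phi> \<eta>)"
proof -
  interpret C: vector_space "scaleC :: complex \<Rightarrow> 'a \<times> 'a \<Rightarrow> 'a \<times> 'a"
    by (rule vector_space_scaleC)
  show ?thesis
  proof (rule C.subspaceI)
    show "0 \<in> h10 \<phi> \<eta>"
      by (simp add: zero_prod_def mem_h10_iff phi_linear_simps eta_linear_simps)
    show "z + w \<in> h10 \<phi> \<eta>" if "z \<in> h10 \<phi> \<eta>" "w \<in> h10 \<phi> \<eta>" for z w
      using that
      by (cases z; cases w) (simp add: mem_h10_iff phi_linear_simps eta_linear_simps)
    show "scaleC c z \<in> h10 \<phi> \<eta>" if "z \<in> h10 \<phi> \<eta>" for c z
      using that
      by (cases z) (simp add: scaleC_def mem_h10_iff phi_linear_simps eta_linear_simps eta_phi phi_phi)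
  qed
qed

lemma ball_h10: "(\<forall>z\<in>h10 \<phi> \<eta>. P z) \<longleftrightarrow> (\<forall>X. \<eta> X = 0 \<longrightarrow> P (X, - \<phi> X))"
  by (metis mem_h10_iff surj_pair)

text \<open>The image of \<open>(X, - \<phi> X)\<close> is
  \<open>(bracket \<xi> X, - bracket \<xi> (\<phi> X))\<close>, so invariance means commutation on
  \<open>Ker \<eta>\<close> together with \<open>\<eta> (bracket \<xi> X) = 0\<close> there.
  Commutation extends to the whole algebra because both sides vanish at \<xi>.\<close>

lemma ad_invariant_h10_iff:
  "ad_invariant (bracketC bracket) (complexify \<xi>) (h10 \<phi> \<eta>) \<longleftrightarrow>
     ad bracket \<xi> \<circ> \<phi> = \<phi> \<circ> ad bracket \<xi>" (is "?L \<longleftrightarrow> ?R")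
proof -
  have L: "?L \<longleftrightarrow> (\<forall>X. \<eta> X = 0 \<longrightarrow> \<eta> (bracket \<xi> X) = 0 \<and> bracket \<xi> (\<phi> X) = \<phi> (bracket \<xi> X))"
    unfolding ad_invariant_def image_subset_iff ball_h10
    by (simp add: ad_def bracketC_def complexify_def mem_h10_iff bracket_linear_simps)
  show ?thesis
  proof
    assume ?L
    have "bracket \<xi> (\<phi> X) = \<phi> (bracket \<xi> X)" for X
    proof -
      \<comment> \<open>The projection of \<open>X\<close> to \<open>Ker \<eta>\<close> along
        \<xi>.\<close>
      let ?X = "X - \<eta> X *\<^sub>R \<xi>"
      have "bracket \<xi> (\<phi> ?X) = \<phi> (bracket \<xi> ?X)"
        using \<open>?L\<close> unfolding L by (simp add: eta_linear_simps eta_xi)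
      then show ?thesis
        by (simp add: phi_linear_simps phi_xi alternating bracket_linear_simps)
    qed
    then show ?R
      by (auto simp: ad_def)
  next
    assume ?R
    then have comm: "bracket \<xi> (\<phi> X) = \<phi> (bracket \<xi> X)" for X
      by (auto simp: ad_def fun_eq_iff)
    have "\<eta> (bracket \<xi> X) = 0" if "\<eta> X = 0" for X
    proof -
      \<comment> \<open>Since \<open>\<phi> (\<phi> X) = - X\<close>, commutation puts the bracket
        into the image of \<phi>, which \<eta> annihilates.\<close>
      have "bracket \<xi> X = - \<phi> (bracket \<xi> (\<phi> X))"
        using that by (simp add: comm[symmetric] phi_phi bracket_linear_simps)
      then show ?thesis
        by (simp add: eta_phi eta_linear_simps)
    qed
    with comm show ?L
      unfolding L by blast
  qed
qed

lemma lie_subalgebra_h10_iff: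
  "lie_subalgebra scaleC (bracketC bracket) (h10 \<phi> \<eta>) \<longleftrightarrow>
     (\<forall>X Y. \<eta> X = 0 \<longrightarrow> \<eta> Y = 0 \<longrightarrow>
       bracket X Y - bracket (\<phi> X) (\<phi> Y) = - \<phi> (bracket (\<phi> X) Y + bracket X (\<phi> Y)))"
  (is "?L \<longleftrightarrow> ?R")
proof -
  let ?A = "\<lambda>X Y. bracket X Y - bracket (\<phi> X) (\<phi> Y)"
  let ?B = "\<lambda>X Y. bracket (\<phi> X) Y + bracket X (\<phi> Y)"
  have L: "?L \<longleftrightarrow> (\<forall>X Y. \<eta> X = 0 \<longrightarrow> \<eta> Y = 0 \<longrightarrow> \<eta> (?A X Y) = 0 \<and> ?B X Y = \<phi> (?A X Y))"
    unfolding lie_subalgebra_def ball_h10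
    by (auto simp: subspace_h10 bracketC_def mem_h10_iff bracket_linear_simps algebra_simps
        minus_equation_iff)
  have rot: "?A (\<phi> X) Y = ?B X Y" "?B (\<phi> X) Y = - ?A X Y" if "\<eta> X = 0" for X Y
    using that by (simp_all add: phi_phi bracket_linear_simps)
  show ?thesis
  proof
    assume ?L
    show ?R
    proof (intro allI impI)
      fix X Y assume X: "\<eta> X = 0" "\<eta> Y = 0"
      \<comment> \<open>The subalgebra condition is used at \<open>\<phi> X\<close>, which lies in
        \<open>Ker \<eta>\<close> by \<open>eta_phi\<close>.\<close>
      then have "?B (\<phi> X) Y = \<phi> (?A (\<phi> X) Y)"
        using \<open>?L\<close> unfolding L by (simp add: eta_phi)
      then have "- ?A X Y = \<phi> (?B X Y)"
        by (simp only: rot[OF X(1)])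
      then show "?A X Y = - \<phi> (?B X Y)"
        by (metis minus_minus)
    qed
  next
    assume R: ?R
    show ?L
      unfolding L
    proof (intro allI impI conjI)
      fix X Y assume X: "\<eta> X = 0" "\<eta> Y = 0"
      show "\<eta> (?A X Y) = 0"
        using R X by (metis eta_phi linear_neg[OF linear_eta] neg_equal_0_iff_equal)
      have "?A (\<phi> X) Y = - \<phi> (?B (\<phi> X) Y)"
        using R X eta_phi by blast
      then have "?B X Y = - \<phi> (- ?A X Y)"
        by (simp only: rot[OF X(1)])
      then show "?B X Y = \<phi> (?A X Y)"
        by (simp only: linear_neg[OF linear_phi] minus_minus)
    qed
  qed
qed

lemma normal_structure_iff:
  "normal_structure bracket \<phi> \<xi> \<eta> \<longleftrightarrow>
     lie_subalgebra scaleC (bracketC bracket) (h10 \<phi> \<eta>) \<and>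
     ad bracket \<xi> \<circ> \<phi> = \<phi> \<circ> ad bracket \<xi>"
proof -
  \<comment> \<open>This is the normality tensor: the term from \<open>d_form\<close> cancels the
    \<xi>-part of \<open>\<phi> (\<phi> (bracket X Y))\<close>, leaving
    \<open>- bracket X Y\<close>.\<close>
  define N where "N = (\<lambda>X Y. bracket (\<phi> X) (\<phi> Y) - bracket X Y
    - \<phi> (bracket (\<phi> X) Y + bracket X (\<phi> Y)))"
  have normal: "normal_structure bracket \<phi> \<xi> \<eta> \<longleftrightarrow> (\<forall>X Y. N X Y = 0)"
    by (simp add: normal_structure_def nijenhuis_def d_form_def N_def phi_phi
        phi_linear_simps algebra_simps)
  have sub: "lie_subalgebra scaleC (bracketC bracket) (h10 \<phi> \<eta>) \<longleftrightarrow>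
      (\<forall>X Y. \<eta> X = 0 \<longrightarrow> \<eta> Y = 0 \<longrightarrow> N X Y = 0)"
    unfolding lie_subalgebra_h10_iff N_def by (auto simp: algebra_simps)
  have N_xi: "N \<xi> Y = - bracket \<xi> Y - \<phi> (bracket \<xi> (\<phi> Y))" for Y
    by (simp add: N_def phi_xi bracket_linear_simps)
  have N_xi': "N Y \<xi> = - N \<xi> Y" for Y
    unfolding N_xi using bracket_antisym[of Y \<xi>] bracket_antisym[of "\<phi> Y" \<xi>]
    by (simp add: N_def phi_xi bracket_linear_simps phi_linear_simps)
  \<comment> \<open>No term in \<open>a * b\<close> occurs, because
    \<open>N \<xi> \<xi> = 0\<close>. Thus \<open>N\<close> is determined by its values on
    \<open>Ker \<eta>\<close> and against \<xi>.\<close>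
  have N_split: "N (X + a *\<^sub>R \<xi>) (Y + b *\<^sub>R \<xi>) = N X Y + a *\<^sub>R N \<xi> Y + b *\<^sub>R N X \<xi>" for X Y a b
    by (simp add: N_def phi_xi alternating bracket_linear_simps phi_linear_simps algebra_simps)
  show ?thesis
  proof
    assume "normal_structure bracket \<phi> \<xi> \<eta>"
    then have N: "N X Y = 0" for X Y
      unfolding normal by blast
    have "bracket \<xi> (\<phi> X) = \<phi> (bracket \<xi> X)" for X
    proof -
      \<comment> \<open>The \<xi>-part of \<open>\<phi> (\<phi> X)\<close> disappears on bracketing
        with \<xi>.\<close>
      have "N \<xi> (\<phi> X) = - bracket \<xi> (\<phi> X) + \<phi> (bracket \<xi> X)"
        by (simp add: N_xi phi_phi bracket_linear_simps phi_linear_simps alternating)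
      then show ?thesis
        by (simp add: N)
    qed
    then show "lie_subalgebra scaleC (bracketC bracket) (h10 \<phi> \<eta>) \<and>
        ad bracket \<xi> \<circ> \<phi> = \<phi> \<circ> ad bracket \<xi>"
      by (auto simp: sub N ad_def)
  next
    assume R: "lie_subalgebra scaleC (bracketC bracket) (h10 \<phi> \<eta>) \<and>
        ad bracket \<xi> \<circ> \<phi> = \<phi> \<circ> ad bracket \<xi>"
    then have comm: "\<phi> (bracket \<xi> X) = bracket \<xi> (\<phi> X)" for X
      by (auto simp: ad_def fun_eq_iff)
    have xi: "N \<xi> Y = 0" for Y
      by (simp add: N_xi comm phi_phi bracket_linear_simps alternating)
    have "N X Y = 0" for X Y
    proof -
      have "N (X - \<eta> X *\<^sub>R \<xi>) (Y - \<eta> Y *\<^sub>R \<xi>) = 0"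
        using R unfolding sub by (simp add: eta_linear_simps eta_xi)
      then show ?thesis
        using N_split[of "X - \<eta> X *\<^sub>R \<xi>" "\<eta> X" "Y - \<eta> Y *\<^sub>R \<xi>" "\<eta> Y"] by (simp add: xi N_xi')
    qed
    then show "normal_structure bracket \<phi> \<xi> \<eta>"
      by (simp add: normal)
  qed
qed

text \<open>The real part of the bracket of two elements is \<open>A\<close>, which gives the
  forward direction. Conversely, \<open>A = 0\<close> at \<open>(\<phi> X, Y)\<close> yields
  \<open>B = 0\<close>, so every bracket is zero and closure is immediate.\<close>

lemma abelian_lie_subalgebra_h10_iff:
  "abelian_lie_subalgebra scaleC (bracketC bracket) (h10 \<phi> \<eta>) \<longleftrightarrow>
     (\<forall>X\<in>Ker \<eta>. \<forall>Y\<in>Ker \<eta>. bracket (\<phi> X) (\<phi> Y) = bracket X Y)" (is "?L \<longleftrightarrow> ?R")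
proof
  assume ?L
  then show ?R
    unfolding abelian_lie_subalgebra_def ball_h10
    by (auto simp: Ker_def bracketC_def zero_prod_def bracket_linear_simps)
next
  assume ?R
  then have A: "bracket (\<phi> X) (\<phi> Y) = bracket X Y" if "\<eta> X = 0" "\<eta> Y = 0" for X Y
    using that by (simp add: Ker_def)
  have B: "bracket (\<phi> X) Y = - bracket X (\<phi> Y)" if "\<eta> X = 0" "\<eta> Y = 0" for X Y
    using A[of "\<phi> X" Y] that by (simp add: eta_phi phi_phi bracket_linear_simps)
  show ?L
    unfolding abelian_lie_subalgebra_def lie_subalgebra_h10_iff ball_h10
    by (simp add: A B bracketC_def zero_prod_def bracket_linear_simps phi_linear_simps)
qed

end

theorem proposition3p3:
  fixes bracket :: "'a::real_vector \<Rightarrow> 'a \<Rightarrow> 'a"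
    and \<phi> :: "'a \<Rightarrow> 'a" and \<xi> :: 'a and \<eta> :: "'a \<Rightarrow> real" and n :: nat
  assumes "almost_contact_lie_algebra n bracket \<phi> \<xi> \<eta>"
  shows "(normal_structure bracket \<phi> \<xi> \<eta> \<longleftrightarrow>
            lie_subalgebra scaleC (bracketC bracket) (h10 \<phi> \<eta>) \<and>
            ad_invariant (bracketC bracket) (complexify \<xi>) (h10 \<phi> \<eta>)) \<and>
         (abelian_structure bracket \<phi> \<xi> \<eta> \<longleftrightarrow>
            abelian_lie_subalgebra scaleC (bracketC bracket) (h10 \<phi> \<eta>) \<and>
            ad_invariant (bracketC bracket) (complexify \<xi>) (h10 \<phi> \<eta>))"
proof -
  interpret almost_contact_lie_algebra n bracket \<phi> \<xi> \<eta> by fact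
  show ?thesis
    unfolding normal_structure_iff abelian_structure_def ad_invariant_h10_iff
      abelian_lie_subalgebra_h10_iff by blast
qed

end
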